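(* Every finite member $\mathbf{A}$ of $\mathsf{CIdInRL}$ can be constructed by the gluing construction starting from all finite Boolean algebras; that is, $\mathbf{A}$ belongs to the smallest class of algebras that contains all finite Boolean algebras and is closed under isomorphic copies and under forming gluings $\mathbf{A}_1\oplus_\varphi\mathbf{A}_2$.
   Context: A commutative idempotent involutive residuated lattice is an algebra $\mathbf{A}=\langle A,\wedge,\vee,\cdot,\to,1,0\rangle$ such that $\langle A,\wedge,\vee\rangle$ is a lattice (with lattice order $\leq$), $\langle A,\cdot,1\rangle$ is a commutative monoid with $x\cdot x=x$ for all $x$, residuation holds ($x\cdot y\leq z \iff y\leq x\to z$), and, writing $-x := x\to 0$, one has $-{-}x=x$ for all $x$. The class of these algebras is $\mathsf{CIdInRL}$. The monoidal order is $x\sqsubseteq y :\Leftrightarrow x\cdot y=x$. Put $0_x := x\wedge -x$ and $A^- := \{x\in A\mid x\leq 1\}$ (negative cone). A Boolean algebra (including the one-element one) is regarded as a member of $\mathsf{CIdInRL}$ with $\cdot=\wedge$, $1$ the top, $0$ the bottom, and $x\to y$ the Boolean implication. Gluing datum: $\mathbf{A},\mathbf{B}\in\mathsf{CIdInRL}$ with $A\cap B=\emptyset$ (operations and orders superscripted by $A$, $B$); an element $a\in A^-$ with $a\nleq 0^A$; an element $b\in B^-$; and a bijection $\varphi\colon\{x\in A\mid a\sqsubseteq^A x\}\to\{y\in B\mid y\sqsubseteq^B b\}$ such that $\varphi(x\cdot^A y)=\varphi(x)\cdot^B\varphi(y)$ and $\varphi(x\vee^A y)=\varphi(x)\vee^B\varphi(y)$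 for all $x,y$ in its domain, and $0_b=\varphi(a\vee^A 0^A)$, where $0_b = b\wedge^B -^B b$. (The domain of $\varphi$ is closed under $\cdot^A,\vee^A$ and contains $a\vee^A 0^A$.) The gluing $\mathbf{A}\oplus_\varphi\mathbf{B}$ (which is a member of $\mathsf{CIdInRL}$) has universe $A\cup B$, constants $0=0^B$, $1=1^B$, involution $-x=-^A x$ for $x\in A$ and $-x=-^B x$ for $x\in B$, and operations: $x\cdot y=x\cdot^A y$ if $x,y\in A$; $x\cdot y=x\cdot^B y$ if $x,y\in B$; $x\cdot y=y\cdot x=x\cdot^A\varphi^{-1}(y\cdot^B b)$ if $x\in A$, $y\in B$. Further $x\vee y=x\vee^A y$ if $x,y\in A$; $x\vee y=x\vee^B y$ if $x,y\in B$; and for $x\in A$, $y\in B$: $x\vee y=y\vee x=\varphi(x\vee^A a)\vee^B y$ if $x\leq^A -^A a$, and $x\vee y=y\vee x=x\vee^A\varphi^{-1}(y\cdot^B b)$ if $x\nleq^A -^A a$. Finally $x\to y := -(-y\cdot x)$ and $x\wedge y := -(-x\vee -y)$. *)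

theory Defs
  imports "HOL-Algebra.Group"
begin

text \<open>
  Algebras of the signature of residuated lattices: the monoid record of HOL-Algebra supplies the
  carrier, the product and the unit. Only the values of the operations on the carrier matter.
\<close>

record 'a rl = "'a monoid" +
  rl_meet :: "'a \<Rightarrow> 'a \<Rightarrow> 'a" (infixl "\<curlywedge>\<index>" 70)
  rl_join :: "'a \<Rightarrow> 'a \<Rightarrow> 'a" (infixl "\<curlyvee>\<index>" 65)
  rl_imp  :: "'a \<Rightarrow> 'a \<Rightarrow> 'a" (infixr "\<leadsto>\<index>" 60)
  rl_zero :: 'a ("\<zero>\<index>")

definition rl_le :: "('a, 'm) rl_scheme \<Rightarrow> 'a \<Rightarrow> 'a \<Rightarrow> bool"
  where "rl_le A x y \<longleftrightarrow> x \<curlywedge>\<^bsub>A\<^esub> y = x"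

definition rl_neg :: "('a, 'm) rl_scheme \<Rightarrow> 'a \<Rightarrow> 'a"
  where "rl_neg A x = x \<leadsto>\<^bsub>A\<^esub> \<zero>\<^bsub>A\<^esub>"

definition monoidal_le :: "('a, 'm) rl_scheme \<Rightarrow> 'a \<Rightarrow> 'a \<Rightarrow> bool"
  where "monoidal_le A x y \<longleftrightarrow> x \<otimes>\<^bsub>A\<^esub> y = x"

definition local_zero :: "('a, 'm) rl_scheme \<Rightarrow> 'a \<Rightarrow> 'a"
  where "local_zero A x = x \<curlywedge>\<^bsub>A\<^esub> rl_neg A x"

definition negative_cone :: "('a, 'm) rl_scheme \<Rightarrow> 'a set"
  where "negative_cone A = {x \<in> carrier A. rl_le A x \<one>\<^bsub>A\<^esub>}"

locale rl_lattice =
  fixes A :: "('a, 'm) rl_scheme" (structure)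
  assumes meet_closed: "\<lbrakk>x \<in> carrier A; y \<in> carrier A\<rbrakk> \<Longrightarrow> x \<curlywedge> y \<in> carrier A"
    and join_closed: "\<lbrakk>x \<in> carrier A; y \<in> carrier A\<rbrakk> \<Longrightarrow> x \<curlyvee> y \<in> carrier A"
    and meet_comm: "\<lbrakk>x \<in> carrier A; y \<in> carrier A\<rbrakk> \<Longrightarrow> x \<curlywedge> y = y \<curlywedge> x"
    and join_comm: "\<lbrakk>x \<in> carrier A; y \<in> carrier A\<rbrakk> \<Longrightarrow> x \<curlyvee> y = y \<curlyvee> x"
    and meet_assoc: "\<lbrakk>x \<in> carrier A; y \<in> carrier A; z \<in> carrier A\<rbrakk>
          \<Longrightarrow> (x \<curlywedge> y) \<curlywedge> z = x \<curlywedge> (y \<curlywedge> z)"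
    and join_assoc: "\<lbrakk>x \<in> carrier A; y \<in> carrier A; z \<in> carrier A\<rbrakk>
          \<Longrightarrow> (x \<curlyvee> y) \<curlyvee> z = x \<curlyvee> (y \<curlyvee> z)"
    and meet_join_absorb: "\<lbrakk>x \<in> carrier A; y \<in> carrier A\<rbrakk> \<Longrightarrow> x \<curlywedge> (x \<curlyvee> y) = x"
    and join_meet_absorb: "\<lbrakk>x \<in> carrier A; y \<in> carrier A\<rbrakk> \<Longrightarrow> x \<curlyvee> (x \<curlywedge> y) = x"

locale CIdInRL = rl_lattice A + comm_monoid A
  for A :: "('a, 'm) rl_scheme" (structure) +
  assumes imp_closed: "\<lbrakk>x \<in> carrier A; y \<in> carrier A\<rbrakk> \<Longrightarrow> x \<leadsto> y \<in> carrier A"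
    and zero_closed: "\<zero> \<in> carrier A"
    and mult_idem: "x \<in> carrier A \<Longrightarrow> x \<otimes> x = x"
    and residuation: "\<lbrakk>x \<in> carrier A; y \<in> carrier A; z \<in> carrier A\<rbrakk>
          \<Longrightarrow> rl_le A (x \<otimes> y) z \<longleftrightarrow> rl_le A y (x \<leadsto> z)"
    and involutive: "x \<in> carrier A \<Longrightarrow> rl_neg A (rl_neg A x) = x"

text \<open>
  A Boolean algebra (a complemented distributive lattice with top \<open>\<one>\<close> and bottom \<open>\<zero>\<close>, which may
  coincide) in the signature of residuated lattices. The complement \<open>c\<close> of \<open>x\<close> is unique by
  distributivity, so the last two assumptions fix the implication to be the Boolean one.
\<close>

locale boolean_rl = rl_lattice A
  for A :: "('a, 'm) rl_scheme" (structure) +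
  assumes one_in: "\<one> \<in> carrier A"
    and zero_in: "\<zero> \<in> carrier A"
    and top: "x \<in> carrier A \<Longrightarrow> rl_le A x \<one>"
    and bottom: "x \<in> carrier A \<Longrightarrow> rl_le A \<zero> x"
    and distrib: "\<lbrakk>x \<in> carrier A; y \<in> carrier A; z \<in> carrier A\<rbrakk>
          \<Longrightarrow> x \<curlywedge> (y \<curlyvee> z) = (x \<curlywedge> y) \<curlyvee> (x \<curlywedge> z)"
    and mult_eq_meet: "\<lbrakk>x \<in> carrier A; y \<in> carrier A\<rbrakk> \<Longrightarrow> x \<otimes> y = x \<curlywedge> y"
    and complement: "x \<in> carrier A \<Longrightarrow> \<exists>c \<in> carrier A. x \<curlywedge> c = \<zero> \<and> x \<curlyvee> c = \<one>"
    and imp_eq: "\<lbrakk>x \<in> carrier A; c \<in> carrier A; x \<curlywedge> c = \<zero>; x \<curlyvee> c = \<one>; y \<in> carrier A\<rbrakk>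
          \<Longrightarrow> x \<leadsto> y = c \<curlyvee> y"

definition rl_iso :: "('a, 'm) rl_scheme \<Rightarrow> ('b, 'n) rl_scheme \<Rightarrow> ('a \<Rightarrow> 'b) set"
  where "rl_iso A B = {f \<in> iso A B.
     (\<forall>x \<in> carrier A. \<forall>y \<in> carrier A.
        f (x \<curlywedge>\<^bsub>A\<^esub> y) = f x \<curlywedge>\<^bsub>B\<^esub> f y \<and>
        f (x \<curlyvee>\<^bsub>A\<^esub> y) = f x \<curlyvee>\<^bsub>B\<^esub> f y \<and>
        f (x \<leadsto>\<^bsub>A\<^esub> y) = f x \<leadsto>\<^bsub>B\<^esub> f y) \<and>
     f \<one>\<^bsub>A\<^esub> = \<one>\<^bsub>B\<^esub> \<and> f \<zero>\<^bsub>A\<^esub> = \<zero>\<^bsub>B\<^esub>}"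

definition glue_dom :: "('a, 'm) rl_scheme \<Rightarrow> 'a \<Rightarrow> 'a set"
  where "glue_dom A a = {x \<in> carrier A. monoidal_le A a x}"

definition glue_cod :: "('a, 'm) rl_scheme \<Rightarrow> 'a \<Rightarrow> 'a set"
  where "glue_cod B b = {y \<in> carrier B. monoidal_le B y b}"

locale gluing_datum = A: CIdInRL A + B: CIdInRL B
  for A :: "('a, 'm) rl_scheme" and B :: "('a, 'n) rl_scheme" +
  fixes a b :: 'a and \<phi> :: "'a \<Rightarrow> 'a"
  assumes disjoint: "carrier A \<inter> carrier B = {}"
    and a_negative: "a \<in> negative_cone A"
    and a_not_le_zero: "\<not> rl_le A a \<zero>\<^bsub>A\<^esub>"
    and b_negative: "b \<in> negative_cone B"
    and bij: "bij_betw \<phi> (glue_dom A a) (glue_cod B b)"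
    and \<phi>_mult: "\<lbrakk>x \<in> glue_dom A a; y \<in> glue_dom A a\<rbrakk> \<Longrightarrow> \<phi> (x \<otimes>\<^bsub>A\<^esub> y) = \<phi> x \<otimes>\<^bsub>B\<^esub> \<phi> y"
    and \<phi>_join: "\<lbrakk>x \<in> glue_dom A a; y \<in> glue_dom A a\<rbrakk> \<Longrightarrow> \<phi> (x \<curlyvee>\<^bsub>A\<^esub> y) = \<phi> x \<curlyvee>\<^bsub>B\<^esub> \<phi> y"
    and \<phi>_zero: "local_zero B b = \<phi> (a \<curlyvee>\<^bsub>A\<^esub> \<zero>\<^bsub>A\<^esub>)"

definition glue_inv :: "('a, 'm) rl_scheme \<Rightarrow> 'a \<Rightarrow> ('a \<Rightarrow> 'a) \<Rightarrow> 'a \<Rightarrow> 'a"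
  where "glue_inv A a \<phi> = inv_into (glue_dom A a) \<phi>"

text \<open>
  The operations of the gluing; they are meant for arguments in the union of the two (disjoint)
  carriers, where not being in the carrier of \<open>A\<close> means being in the carrier of \<open>B\<close>.
\<close>

definition glue_neg :: "('a, 'm) rl_scheme \<Rightarrow> ('a, 'n) rl_scheme \<Rightarrow> 'a \<Rightarrow> 'a"
  where "glue_neg A B x = (if x \<in> carrier A then rl_neg A x else rl_neg B x)"

definition glue_mult ::
    "('a, 'm) rl_scheme \<Rightarrow> ('a, 'n) rl_scheme \<Rightarrow> 'a \<Rightarrow> 'a \<Rightarrow> ('a \<Rightarrow> 'a) \<Rightarrow> 'a \<Rightarrow> 'a \<Rightarrow> 'a"
  where "glue_mult A B a b \<phi> x y =
    (let mixed = (\<lambda>u v. u \<otimes>\<^bsub>A\<^esub> glue_inv A a \<phi> (v \<otimes>\<^bsub>B\<^esub> b))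
     in if x \<in> carrier A
        then (if y \<in> carrier A then x \<otimes>\<^bsub>A\<^esub> y else mixed x y)
        else (if y \<in> carrier A then mixed y x else x \<otimes>\<^bsub>B\<^esub> y))"

definition glue_join ::
    "('a, 'm) rl_scheme \<Rightarrow> ('a, 'n) rl_scheme \<Rightarrow> 'a \<Rightarrow> 'a \<Rightarrow> ('a \<Rightarrow> 'a) \<Rightarrow> 'a \<Rightarrow> 'a \<Rightarrow> 'a"
  where "glue_join A B a b \<phi> x y =
    (let mixed = (\<lambda>u v. if rl_le A u (rl_neg A a)
                        then \<phi> (u \<curlyvee>\<^bsub>A\<^esub> a) \<curlyvee>\<^bsub>B\<^esub> v
                        else u \<curlyvee>\<^bsub>A\<^esub> glue_inv A a \<phi> (v \<otimes>\<^bsub>B\<^esub> b))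
     in if x \<in> carrier A
        then (if y \<in> carrier A then x \<curlyvee>\<^bsub>A\<^esub> y else mixed x y)
        else (if y \<in> carrier A then mixed y x else x \<curlyvee>\<^bsub>B\<^esub> y))"

definition gluing ::
    "('a, 'm) rl_scheme \<Rightarrow> ('a, 'n) rl_scheme \<Rightarrow> 'a \<Rightarrow> 'a \<Rightarrow> ('a \<Rightarrow> 'a) \<Rightarrow> 'a rl"
  where "gluing A B a b \<phi> =
    \<lparr>carrier = carrier A \<union> carrier B,
     mult = glue_mult A B a b \<phi>,
     one = \<one>\<^bsub>B\<^esub>,
     rl_meet = (\<lambda>x y. glue_neg A B (glue_join A B a b \<phi> (glue_neg A B x) (glue_neg A B y))),
     rl_join = glue_join A B a b \<phi>,
     rl_imp = (\<lambda>x y. glue_neg A B (glue_mult A B a b \<phi> (glue_neg A B y) x)),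
     rl_zero = \<zero>\<^bsub>B\<^esub>\<rparr>"

text \<open>
  The smallest class containing the finite Boolean algebras and closed under isomorphic copies and
  gluings, formed among the algebras whose carrier is a subset of the type \<open>'a\<close>. Since the carrier of
  a gluing is the disjoint union of the carriers of its two parts, every algebra used in building
  a given one has an isomorphic copy inside its carrier, so the choice of \<open>'a\<close> is immaterial.
\<close>

inductive gluing_constructible :: "'a rl \<Rightarrow> bool" where
  boolean: "\<lbrakk>boolean_rl A; finite (carrier A)\<rbrakk> \<Longrightarrow> gluing_constructible A"
| isomorphic: "\<lbrakk>gluing_constructible A; f \<in> rl_iso A B\<rbrakk> \<Longrightarrow> gluing_constructible B"
| glue: "\<lbrakk>gluing_constructible A; gluing_constructible B; gluing_datum A B a b \<phi>\<rbrakk>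
    \<Longrightarrow> gluing_constructible (gluing A B a b \<phi>)"

end

theory Submission
  imports Defs
begin

text \<open>
  Put \<open>1\<^sub>x = x \<or> -x\<close>, so that \<open>-1\<^sub>x = 0\<^sub>x\<close>. The elements \<open>q \<ge> 1\<close> form a distributive
  lattice \<open>P\<close> in which products are joins. If \<open>P = {1}\<close>, then \<open>\<^bold>A\<close> is Boolean. Otherwise choose an atom \<open>e\<close>
  of \<open>P\<close>. It is join-prime, so there is a largest \<open>p \<in> P\<close> that is not above \<open>e\<close>. With \<open>c = -p\<close>, the carrier is
  the disjoint union of the interval \<open>[c, p] = {x. 1\<^sub>x \<le> p}\<close>, a subalgebra, and of
  \<open>{x. e x = x} = {x. e \<le> 1\<^sub>x}\<close>, which has unit \<open>e\<close>; both are smaller than \<open>\<^bold>A\<close>. Let \<open>b\<close> be the least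
  \<open>y \<in> [0, 1]\<close> with \<open>e y = e\<close>. Then \<open>w \<mapsto> e w\<close> is a bijection from \<open>{w \<in> [c, p]. w \<sqsubseteq> b}\<close> onto
  \<open>{x. e x = x, e c \<sqsubseteq> x}\<close>, and gluing along its inverse gives back the operations of \<open>\<^bold>A\<close>.
  The bijectivity is the crux: if \<open>e c \<sqsubseteq> x\<close> then \<open>e (x \<and> p) = x\<close>, and if \<open>e w = e w'\<close> then
  \<open>b \<le> -w \<or> w'\<close>, whence \<open>w = w b \<le> 0\<^sub>w \<or> w w' \<le> w'\<close>.
\<close>

section \<open>Lattice order and extremal elements of finite sets\<close>

context rl_lattice
begin

abbreviation le (infix "\<preceq>" 50)
  where "x \<preceq> y \<equiv> rl_le A x y"

lemma join_idem: "x \<in> carrier A \<Longrightarrow> x \<curlyvee> x = x"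
  by (metis join_meet_absorb meet_join_absorb join_closed)

lemma le_refl: "x \<in> carrier A \<Longrightarrow> x \<preceq> x"
  unfolding rl_le_def by (metis join_meet_absorb meet_join_absorb meet_closed)

lemma le_antisym: "\<lbrakk>x \<preceq> y; y \<preceq> x; x \<in> carrier A; y \<in> carrier A\<rbrakk> \<Longrightarrow> x = y"
  unfolding rl_le_def by (metis meet_comm)

lemma le_trans: "\<lbrakk>x \<preceq> y; y \<preceq> z; x \<in> carrier A; y \<in> carrier A; z \<in> carrier A\<rbrakk> \<Longrightarrow> x \<preceq> z"
  unfolding rl_le_def by (metis meet_assoc)

lemma le_iff_join: "\<lbrakk>x \<in> carrier A; y \<in> carrier A\<rbrakk> \<Longrightarrow> x \<preceq> y \<longleftrightarrow> x \<curlyvee> y = y"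
  unfolding rl_le_def by (metis join_comm join_meet_absorb meet_comm meet_join_absorb)

lemma le_meet_iff:
  assumes "x \<in> carrier A" "y \<in> carrier A" "z \<in> carrier A"
  shows "z \<preceq> x \<curlywedge> y \<longleftrightarrow> z \<preceq> x \<and> z \<preceq> y"
proof -
  have "x \<curlywedge> y \<preceq> x" "x \<curlywedge> y \<preceq> y"
    using assms le_refl unfolding rl_le_def by (metis meet_assoc meet_comm meet_closed)+
  then show ?thesis
    using assms le_trans meet_closed unfolding rl_le_def by (metis meet_assoc)
qed

lemma join_le_iff:
  assumes "x \<in> carrier A" "y \<in> carrier A" "z \<in> carrier A"
  shows "x \<curlyvee> y \<preceq> z \<longleftrightarrow> x \<preceq> z \<and> y \<preceq> z"
proof -
  have "x \<preceq> x \<curlyvee> y" "y \<preceq> x \<curlyvee> y"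
    using assms unfolding rl_le_def by (metis meet_join_absorb join_comm)+
  moreover have "x \<curlyvee> y \<preceq> z" if "x \<preceq> z" "y \<preceq> z"
    using assms that by (simp add: le_iff_join join_closed join_assoc)
  ultimately show ?thesis
    using assms le_trans join_closed by meson
qed

lemma meet_le1: "\<lbrakk>x \<in> carrier A; y \<in> carrier A\<rbrakk> \<Longrightarrow> x \<curlywedge> y \<preceq> x"
  and meet_le2: "\<lbrakk>x \<in> carrier A; y \<in> carrier A\<rbrakk> \<Longrightarrow> x \<curlywedge> y \<preceq> y"
  using le_meet_iff le_refl meet_closed by blast+

lemma join_ge1: "\<lbrakk>x \<in> carrier A; y \<in> carrier A\<rbrakk> \<Longrightarrow> x \<preceq> x \<curlyvee> y"
  and join_ge2: "\<lbrakk>x \<in> carrier A; y \<in> carrier A\<rbrakk> \<Longrightarrow> y \<preceq> x \<curlyvee> y"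
  using join_le_iff le_refl join_closed by blast+

text \<open>Extremal elements of a finite set are available for relations that are transitive and
  asymmetric on it; the strict part of \<preceq> is such a relation as long as the set stays inside
  the carrier.\<close>

lemma strict_order_on_subset:
  assumes "S \<subseteq> carrier A"
  shows "transp_on S (\<lambda>x y. x \<preceq> y \<and> x \<noteq> y)" "asymp_on S (\<lambda>x y. x \<preceq> y \<and> x \<noteq> y)"
proof -
  have S: "x \<in> carrier A" if "x \<in> S" for x
    using assms that by blast
  show "transp_on S (\<lambda>x y. x \<preceq> y \<and> x \<noteq> y)"
  proof (rule transp_onI)
    fix x y z
    assume "x \<in> S" "y \<in> S" "z \<in> S" "x \<preceq> y \<and> x \<noteq> y" "y \<preceq> z \<and> y \<noteq> z"
    then show "x \<preceq> z \<and> x \<noteq> z"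
      using S le_trans[of x y z] le_antisym[of x y] by auto
  qed
  show "asymp_on S (\<lambda>x y. x \<preceq> y \<and> x \<noteq> y)"
  proof (rule asymp_onI)
    fix x y
    assume "x \<in> S" "y \<in> S" "x \<preceq> y \<and> x \<noteq> y"
    then show "\<not> (y \<preceq> x \<and> y \<noteq> x)"
      using S le_antisym[of x y] by auto
  qed
qed

lemma exists_maximal:
  assumes "finite (carrier A)" "S \<subseteq> carrier A" "S \<noteq> {}"
  shows "\<exists>m \<in> S. \<forall>x \<in> S. m \<preceq> x \<longrightarrow> x = m"
  using Finite_Set.bex_max_element[OF finite_subset[OF assms(2,1)] strict_order_on_subset(2,1)[OF assms(2)]
      assms(3)] by blast

lemma exists_minimal:
  assumes "finite (carrier A)" "S \<subseteq> carrier A" "S \<noteq> {}"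
  shows "\<exists>m \<in> S. \<forall>x \<in> S. x \<preceq> m \<longrightarrow> x = m"
  using Finite_Set.bex_min_element[OF finite_subset[OF assms(2,1)] strict_order_on_subset(2,1)[OF assms(2)]
      assms(3)] by blast

end

section \<open>Residuation, involution and products\<close>

context CIdInRL
begin

abbreviation neg ("\<sim> _" [81] 80)
  where "\<sim> x \<equiv> rl_neg A x"

lemma neg_closed: "x \<in> carrier A \<Longrightarrow> \<sim> x \<in> carrier A"
  unfolding rl_neg_def by (simp add: imp_closed zero_closed)

lemmas closed [simp, intro] = meet_closed join_closed imp_closed zero_closed neg_closed

lemma le_neg_iff: "\<lbrakk>x \<in> carrier A; y \<in> carrier A\<rbrakk> \<Longrightarrow> x \<preceq> \<sim> y \<longleftrightarrow> y \<otimes> x \<preceq> \<zero>"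
  unfolding rl_neg_def by (simp add: residuation)

lemma neg_le_neg_iff:
  "\<lbrakk>x \<in> carrier A; y \<in> carrier A\<rbrakk> \<Longrightarrow> \<sim> y \<preceq> \<sim> x \<longleftrightarrow> x \<preceq> y"
  by (metis involutive le_neg_iff m_comm neg_closed)

lemma neg_le_iff: "\<lbrakk>x \<in> carrier A; y \<in> carrier A\<rbrakk> \<Longrightarrow> \<sim> y \<preceq> x \<longleftrightarrow> \<sim> x \<preceq> y"
  by (metis involutive neg_closed neg_le_neg_iff)

lemma le_iff_mult_neg: "\<lbrakk>x \<in> carrier A; y \<in> carrier A\<rbrakk> \<Longrightarrow> x \<preceq> y \<longleftrightarrow> x \<otimes> \<sim> y \<preceq> \<zero>"
  by (metis involutive le_neg_iff m_comm neg_closed)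

lemma neg_one: "\<sim> \<one> = \<zero>"
proof (rule le_antisym)
  show "\<sim> \<one> \<preceq> \<zero>"
    using le_neg_iff[of "\<sim> \<one>" \<one>] le_refl by simp
  show "\<zero> \<preceq> \<sim> \<one>"
    by (simp add: le_neg_iff le_refl)
qed auto

lemma neg_zero: "\<sim> \<zero> = \<one>"
  using involutive[of \<one>] by (simp add: neg_one)

text \<open>Both sides say that the product of \<open>x\<close>, \<open>y\<close> and
  \<open>u\<close> lies below \<open>\<zero>\<close>.\<close>

lemma le_imp_iff:
  assumes "x \<in> carrier A" "y \<in> carrier A" "u \<in> carrier A"
  shows "u \<preceq> \<sim> (x \<otimes> y) \<longleftrightarrow> x \<otimes> u \<preceq> \<sim> y"
proof -
  have "x \<otimes> y \<otimes> u = y \<otimes> (x \<otimes> u)"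
    using assms by (simp add: m_ac)
  then show ?thesis
    using assms by (simp add: le_neg_iff)
qed

text \<open>The same elements \<open>u\<close> lie below both sides, namely those with
  \<open>x \<otimes> u \<preceq> y\<close>.\<close>

lemma imp_eq_neg:
  assumes "x \<in> carrier A" "y \<in> carrier A"
  shows "x \<leadsto> y = \<sim> (\<sim> y \<otimes> x)"
proof -
  have "u \<preceq> x \<leadsto> y \<longleftrightarrow> u \<preceq> \<sim> (\<sim> y \<otimes> x)" if "u \<in> carrier A" for u
    using assms that by (simp add: residuation[symmetric] m_comm[of "\<sim> y"] le_imp_iff involutive)
  then show ?thesis
    using assms le_refl le_antisym by (metis imp_closed m_closed neg_closed)
qed

lemma mult_mono_left:
  assumes "y \<preceq> z" "x \<in> carrier A" "y \<in> carrier A" "z \<in> carrier A"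
  shows "x \<otimes> y \<preceq> x \<otimes> z"
proof -
  have "z \<preceq> x \<leadsto> (x \<otimes> z)"
    using assms by (simp add: residuation[symmetric] le_refl)
  then show ?thesis
    using assms le_trans[of y z "x \<leadsto> (x \<otimes> z)"] by (simp add: residuation)
qed

lemma mult_mono:
  assumes "x \<preceq> x'" "y \<preceq> y'" "x \<in> carrier A" "y \<in> carrier A" "x' \<in> carrier A" "y' \<in> carrier A"
  shows "x \<otimes> y \<preceq> x' \<otimes> y'"
proof (rule le_trans)
  show "x \<otimes> y \<preceq> x \<otimes> y'" "x \<otimes> y' \<preceq> x' \<otimes> y'"
    using assms mult_mono_left m_comm by metis+
qed (use assms in auto)

text \<open>Multiplication by \<open>x\<close> is a lower adjoint by residuation, so it preserves
  joins.\<close>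

lemma mult_join_distrib:
  assumes "x \<in> carrier A" "y \<in> carrier A" "z \<in> carrier A"
  shows "x \<otimes> (y \<curlyvee> z) = (x \<otimes> y) \<curlyvee> (x \<otimes> z)"
proof (rule le_antisym)
  have "y \<preceq> x \<leadsto> ((x \<otimes> y) \<curlyvee> (x \<otimes> z))" "z \<preceq> x \<leadsto> ((x \<otimes> y) \<curlyvee> (x \<otimes> z))"
    using assms by (simp_all add: residuation[symmetric] join_ge1 join_ge2)
  then show "x \<otimes> (y \<curlyvee> z) \<preceq> (x \<otimes> y) \<curlyvee> (x \<otimes> z)"
    using assms by (simp add: residuation join_le_iff)
  show "(x \<otimes> y) \<curlyvee> (x \<otimes> z) \<preceq> x \<otimes> (y \<curlyvee> z)"
    using assms by (simp add: join_le_iff mult_mono_left join_ge1 join_ge2)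
qed (use assms in auto)

lemma neg_join:
  assumes "x \<in> carrier A" "y \<in> carrier A"
  shows "\<sim> (x \<curlyvee> y) = \<sim> x \<curlywedge> \<sim> y"
proof (rule le_antisym)
  have "x \<preceq> \<sim> (\<sim> x \<curlywedge> \<sim> y)" "y \<preceq> \<sim> (\<sim> x \<curlywedge> \<sim> y)"
    using assms meet_le1[of "\<sim> x" "\<sim> y"] meet_le2[of "\<sim> x" "\<sim> y"]
      neg_le_neg_iff[of "\<sim> x \<curlywedge> \<sim> y"] by (metis closed(1,5) involutive)+
  then have "x \<curlyvee> y \<preceq> \<sim> (\<sim> x \<curlywedge> \<sim> y)"
    using assms by (simp add: join_le_iff)
  then have "\<sim> (\<sim> (\<sim> x \<curlywedge> \<sim> y)) \<preceq> \<sim> (x \<curlyvee> y)"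
    using assms by (simp only: neg_le_neg_iff closed)
  then show "\<sim> x \<curlywedge> \<sim> y \<preceq> \<sim> (x \<curlyvee> y)"
    using assms by (simp add: involutive)
qed (use assms in \<open>auto simp: le_meet_iff neg_le_neg_iff join_ge1 join_ge2\<close>)

lemma neg_meet:
  "\<lbrakk>x \<in> carrier A; y \<in> carrier A\<rbrakk> \<Longrightarrow> \<sim> (x \<curlywedge> y) = \<sim> x \<curlyvee> \<sim> y"
  by (metis closed(2,5) involutive neg_join)

text \<open>Idempotence gives both bounds: a further factor \<open>x\<close> or
  \<open>\<sim> x\<close> leaves \<open>x \<otimes> \<sim> x\<close> unchanged, hence below
  \<open>\<zero>\<close>, which puts it below \<open>\<sim> x\<close> and \<open>x\<close>;
  conversely, the meet equals its own square.\<close>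

lemma mult_neg:
  assumes "x \<in> carrier A"
  shows "x \<otimes> \<sim> x = x \<curlywedge> \<sim> x"
proof (rule le_antisym)
  have *: "x \<otimes> \<sim> x \<preceq> \<zero>"
    using assms by (simp add: le_iff_mult_neg[symmetric] le_refl)
  have "x \<otimes> \<sim> x \<otimes> \<sim> x = x \<otimes> \<sim> x" "x \<otimes> (x \<otimes> \<sim> x) = x \<otimes> \<sim> x"
    using assms mult_idem by (simp add: m_assoc) (use assms mult_idem m_assoc neg_closed in metis)
  then show "x \<otimes> \<sim> x \<preceq> x \<curlywedge> \<sim> x"
    using assms * by (simp add: le_meet_iff le_iff_mult_neg[of "x \<otimes> \<sim> x" x] le_neg_iff)
  have "(x \<curlywedge> \<sim> x) \<otimes> (x \<curlywedge> \<sim> x) \<preceq> x \<otimes> \<sim> x"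
    using assms by (simp add: mult_mono meet_le1 meet_le2)
  then show "x \<curlywedge> \<sim> x \<preceq> x \<otimes> \<sim> x"
    using assms by (simp add: mult_idem)
qed (use assms in auto)

lemma zero_le_one: "\<zero> \<preceq> \<one>"
  using mult_neg[of \<one>] meet_le1[of \<one> \<zero>] by (simp add: neg_one)

lemma mult_le_right: "\<lbrakk>x \<preceq> \<one>; x \<in> carrier A; y \<in> carrier A\<rbrakk> \<Longrightarrow> x \<otimes> y \<preceq> y"
  using mult_mono_left[of x \<one> y] by (simp add: m_comm)

lemma le_mult_right: "\<lbrakk>\<one> \<preceq> x; x \<in> carrier A; y \<in> carrier A\<rbrakk> \<Longrightarrow> y \<preceq> x \<otimes> y"
  using mult_mono_left[of \<one> x y] by (simp add: m_comm)

lemma mult_le_left: "\<lbrakk>y \<preceq> \<one>; x \<in> carrier A; y \<in> carrier A\<rbrakk> \<Longrightarrow> x \<otimes> y \<preceq> x"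
  using mult_le_right[of y x] by (simp add: m_comm)

lemma le_mult_left: "\<lbrakk>\<one> \<preceq> y; x \<in> carrier A; y \<in> carrier A\<rbrakk> \<Longrightarrow> x \<preceq> x \<otimes> y"
  using le_mult_right[of y x] by (simp add: m_comm)

text \<open>A negative factor can only decrease the other one, while the meet equals its square,
  which lies below the product.\<close>

lemma mult_eq_meet_negative:
  assumes "x \<preceq> \<one>" "y \<preceq> \<one>" "x \<in> carrier A" "y \<in> carrier A"
  shows "x \<otimes> y = x \<curlywedge> y"
proof (rule le_antisym)
  show "x \<otimes> y \<preceq> x \<curlywedge> y"
    using assms by (simp add: le_meet_iff mult_le_left mult_le_right)
  have "(x \<curlywedge> y) \<otimes> (x \<curlywedge> y) \<preceq> x \<otimes> y"
    using assms by (simp add: mult_mono meet_le1 meet_le2)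
  then show "x \<curlywedge> y \<preceq> x \<otimes> y"
    using assms by (simp add: mult_idem)
qed (use assms in auto)

lemma mult_eq_join_positive:
  assumes "\<one> \<preceq> x" "\<one> \<preceq> y" "x \<in> carrier A" "y \<in> carrier A"
  shows "x \<otimes> y = x \<curlyvee> y"
proof (rule le_antisym)
  show "x \<curlyvee> y \<preceq> x \<otimes> y"
    using assms by (simp add: join_le_iff le_mult_left le_mult_right)
  have "x \<otimes> y \<preceq> (x \<curlyvee> y) \<otimes> (x \<curlyvee> y)"
    using assms by (simp add: mult_mono join_ge1 join_ge2)
  then show "x \<otimes> y \<preceq> x \<curlyvee> y"
    using assms by (simp add: mult_idem)
qed (use assms in auto)

lemma neg_le_zero_iff: "x \<in> carrier A \<Longrightarrow> \<sim> x \<preceq> \<zero> \<longleftrightarrow> \<one> \<preceq> x"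
  using neg_le_neg_iff[of \<one> x] by (simp add: neg_one)

section \<open>Local units\<close>

text \<open>Written \<open>1\<^sub>x\<close> in the literature, dually to \<open>0\<^sub>x\<close>.\<close>

definition local_one ("\<I>")
  where "\<I> x = x \<curlyvee> \<sim> x"

lemma local_one_closed [simp, intro]: "x \<in> carrier A \<Longrightarrow> \<I> x \<in> carrier A"
  by (simp add: local_one_def)

lemma neg_local_one: "x \<in> carrier A \<Longrightarrow> \<sim> (\<I> x) = x \<otimes> \<sim> x"
  by (simp add: local_one_def neg_join involutive mult_neg meet_comm)

text \<open>Since \<open>\<sim> (\<I> x) = x \<otimes> \<sim> x\<close>, both sides say that
  \<open>q \<otimes> x \<otimes> \<sim> x\<close> lies below \<open>\<zero>\<close>. So
  \<open>\<I> x\<close> is the largest \<open>q\<close> with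
  \<open>q \<otimes> x \<preceq> x\<close>, and later proofs place elements below a local unit this
  way.\<close>

lemma le_local_one_iff:
  assumes "q \<in> carrier A" "x \<in> carrier A"
  shows "q \<preceq> \<I> x \<longleftrightarrow> q \<otimes> x \<preceq> x"
proof -
  have "q \<preceq> \<I> x \<longleftrightarrow> q \<otimes> (x \<otimes> \<sim> x) \<preceq> \<zero>"
    using assms by (simp add: le_iff_mult_neg neg_local_one)
  then show ?thesis
    using assms by (simp add: le_iff_mult_neg[of "q \<otimes> x"] m_assoc)
qed

lemma one_le_local_one: "x \<in> carrier A \<Longrightarrow> \<one> \<preceq> \<I> x"
  by (simp add: le_local_one_iff le_refl)

lemma local_one_mult: "x \<in> carrier A \<Longrightarrow> \<I> x \<otimes> x = x"
  by (rule le_antisym) (auto simp: le_local_one_iff[symmetric] le_refl le_mult_right one_le_local_one)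

text \<open>Of the two joinands of \<open>\<I> (q \<otimes> x)\<close>, the first is bounded by
  monotonicity, the second by
  \<open>\<sim> (q \<otimes> x) \<preceq> \<sim> x \<preceq> \<I> x\<close>, where positivity of
  \<open>q\<close> is used.\<close>

lemma local_one_mult_le:
  assumes "\<one> \<preceq> q" "q \<in> carrier A" "x \<in> carrier A"
  shows "\<I> (q \<otimes> x) \<preceq> q \<otimes> \<I> x"
proof -
  have "q \<otimes> \<sim> (q \<otimes> x) \<preceq> \<sim> x"
    using assms by (simp add: le_imp_iff[symmetric] le_refl)
  then have "\<sim> (q \<otimes> x) \<preceq> \<sim> x"
    using assms le_trans[OF le_mult_right[OF assms(1,2)]] by auto
  then have "\<sim> (q \<otimes> x) \<preceq> q \<otimes> \<I> x"
    using assms le_trans[of _ "\<sim> x"] le_trans[of "\<sim> x" "\<I> x"]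
    by (simp add: local_one_def join_ge2 le_mult_right)
  then show ?thesis
    using assms by (simp add: local_one_def[of "q \<otimes> x"] join_le_iff)
      (simp add: local_one_def join_ge1 mult_mono_left)
qed

lemma le_local_one: "x \<in> carrier A \<Longrightarrow> x \<preceq> \<I> x"
  by (simp add: le_local_one_iff mult_idem le_refl)

section \<open>Distributivity of the negative and the positive cone\<close>

lemma negative_meet_join:
  assumes "x \<preceq> \<one>" "y \<preceq> \<one>" "z \<preceq> \<one>" "x \<in> carrier A" "y \<in> carrier A" "z \<in> carrier A"
  shows "x \<curlywedge> (y \<curlyvee> z) = (x \<curlywedge> y) \<curlyvee> (x \<curlywedge> z)"
  using assms by (simp add: mult_eq_meet_negative[symmetric] mult_join_distrib join_le_iff)

text \<open>In the negative cone the meet of the two joins is their product; after expansion every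
  term containing \<open>x\<close> falls below \<open>x\<close>.\<close>

lemma negative_join_meet:
  assumes "x \<preceq> \<one>" "y \<preceq> \<one>" "z \<preceq> \<one>" "x \<in> carrier A" "y \<in> carrier A" "z \<in> carrier A"
  shows "x \<curlyvee> (y \<curlywedge> z) = (x \<curlyvee> y) \<curlywedge> (x \<curlyvee> z)"
proof (rule le_antisym)
  show "x \<curlyvee> (y \<curlywedge> z) \<preceq> (x \<curlyvee> y) \<curlywedge> (x \<curlyvee> z)"
    using assms le_trans[of "y \<curlywedge> z" y "x \<curlyvee> y"] le_trans[of "y \<curlywedge> z" z "x \<curlyvee> z"]
    by (simp add: le_meet_iff join_le_iff join_ge1 join_ge2 meet_le1 meet_le2)
  have "(x \<curlyvee> y) \<otimes> (x \<curlyvee> z) \<preceq> x \<curlyvee> (y \<otimes> z)"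
  proof -
    have "x \<preceq> x \<curlyvee> (y \<otimes> z)" "y \<otimes> z \<preceq> x \<curlyvee> (y \<otimes> z)"
      using assms by (simp_all add: join_ge1 join_ge2)
    moreover have "(x \<curlyvee> y) \<otimes> x \<preceq> x" "x \<otimes> z \<preceq> x"
      using assms by (simp_all add: mult_le_right mult_le_left join_le_iff)
    ultimately have "(x \<curlyvee> y) \<otimes> x \<preceq> x \<curlyvee> (y \<otimes> z)" "z \<otimes> x \<preceq> x \<curlyvee> (y \<otimes> z)" "z \<otimes> y \<preceq> x \<curlyvee> (y \<otimes> z)"
      using assms le_trans[of _ x "x \<curlyvee> (y \<otimes> z)"] by (simp_all add: m_comm)
    moreover have "(x \<curlyvee> y) \<otimes> z = z \<otimes> x \<curlyvee> z \<otimes> y"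
      using assms by (simp add: m_comm[of "x \<curlyvee> y"] mult_join_distrib)
    ultimately show ?thesis
      using assms by (simp add: mult_join_distrib[of "x \<curlyvee> y"] join_le_iff)
  qed
  then show "(x \<curlyvee> y) \<curlywedge> (x \<curlyvee> z) \<preceq> x \<curlyvee> (y \<curlywedge> z)"
    using assms by (simp add: mult_eq_meet_negative join_le_iff)
qed (use assms in auto)

lemma neg_le_one: "\<lbrakk>\<one> \<preceq> x; x \<in> carrier A\<rbrakk> \<Longrightarrow> \<sim> x \<preceq> \<one>"
  using le_trans[OF _ zero_le_one, of "\<sim> x"] by (simp add: neg_le_zero_iff)

lemma neg_eq_iff: "\<lbrakk>x \<in> carrier A; y \<in> carrier A\<rbrakk> \<Longrightarrow> \<sim> x = \<sim> y \<longleftrightarrow> x = y"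
  by (metis involutive)

text \<open>Negation sends the positive cone into the negative one and exchanges meet with join, so
  the dual law for negative elements applies.\<close>

lemma positive_meet_join:
  assumes "\<one> \<preceq> x" "\<one> \<preceq> y" "\<one> \<preceq> z" "x \<in> carrier A" "y \<in> carrier A" "z \<in> carrier A"
  shows "x \<curlywedge> (y \<curlyvee> z) = (x \<curlywedge> y) \<curlyvee> (x \<curlywedge> z)"
  using assms negative_join_meet[of "\<sim> x" "\<sim> y" "\<sim> z"]
  by (subst neg_eq_iff[symmetric]) (simp_all add: neg_le_one neg_meet neg_join)

lemma positive_join_meet:
  assumes "\<one> \<preceq> x" "\<one> \<preceq> y" "\<one> \<preceq> z" "x \<in> carrier A" "y \<in> carrier A" "z \<in> carrier A"
  shows "x \<curlyvee> (y \<curlywedge> z) = (x \<curlyvee> y) \<curlywedge> (x \<curlyvee> z)"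
  using assms negative_meet_join[of "\<sim> x" "\<sim> y" "\<sim> z"]
  by (subst neg_eq_iff[symmetric]) (simp_all add: neg_le_one neg_meet neg_join)

section \<open>The Boolean case\<close>

lemma boolean_if_positive_cone_trivial:
  assumes trivial: "\<And>x. \<lbrakk>x \<in> carrier A; \<one> \<preceq> x\<rbrakk> \<Longrightarrow> x = \<one>"
  shows "boolean_rl A"
proof -
  \<comment> \<open>Local units are positive, so the hypothesis collapses them all to
    \<open>\<one>\<close>; this makes \<open>\<sim> x\<close> a complement of
    \<open>x\<close>.\<close>
  have join_neg: "x \<curlyvee> \<sim> x = \<one>" if "x \<in> carrier A" for x
    using that trivial one_le_local_one by (metis local_one_closed local_one_def)
  have top: "x \<preceq> \<one>" if "x \<in> carrier A" for x
    using that join_neg join_ge1 by (metis closed(5))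
  have mult_meet: "x \<otimes> y = x \<curlywedge> y" if "x \<in> carrier A" "y \<in> carrier A" for x y
    using that by (simp add: mult_eq_meet_negative top)
  have meet_neg: "x \<curlywedge> \<sim> x = \<zero>" if "x \<in> carrier A" for x
    using that join_neg neg_join[of x "\<sim> x"] by (simp add: involutive meet_comm neg_one)
  show ?thesis
  proof
    fix x y z c
    assume x: "x \<in> carrier A" and y: "y \<in> carrier A"
    show "x \<preceq> \<one>"
      using x by (rule top)
    show "\<zero> \<preceq> x"
      using x top neg_le_iff[of \<one> x] by (simp add: neg_one)
    show "x \<otimes> y = x \<curlywedge> y"
      using x y by (rule mult_meet)
    show "\<exists>c \<in> carrier A. x \<curlywedge> c = \<zero> \<and> x \<curlyvee> c = \<one>"
      using x join_neg meet_neg by blast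
    show "x \<curlywedge> (y \<curlyvee> z) = (x \<curlywedge> y) \<curlyvee> (x \<curlywedge> z)" if "z \<in> carrier A"
      using x y that by (simp add: negative_meet_join top)
    show "x \<leadsto> y = c \<curlyvee> y" if c: "c \<in> carrier A" "x \<curlywedge> c = \<zero>" "x \<curlyvee> c = \<one>"
    proof -
      \<comment> \<open>The implication is prescribed through an arbitrary complement
        \<open>c\<close>, which has to be identified with \<open>\<sim> x\<close>. Multiplying
        \<open>x \<curlyvee> c = \<one>\<close> by \<open>\<sim> x\<close> gives
        \<open>\<sim> x \<preceq> c\<close>.\<close>
      have "\<sim> x \<otimes> (x \<curlyvee> c) = (\<sim> x \<otimes> x) \<curlyvee> (\<sim> x \<otimes> c)"
        using x c by (intro mult_join_distrib) auto
      then have "\<sim> x = \<zero> \<curlyvee> (\<sim> x \<otimes> c)"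
        using x c mult_neg[of x] meet_neg[of x] by (simp add: m_comm[of "\<sim> x" x])
      moreover have "\<zero> \<preceq> c" "\<sim> x \<otimes> c \<preceq> c"
        using x c top meet_le2[of x c] by (simp_all add: mult_le_right)
      ultimately have "\<sim> x \<preceq> c"
        using x c join_le_iff[of \<zero> "\<sim> x \<otimes> c" c] by simp
      moreover have "c \<preceq> \<sim> x"
        using x c by (simp add: le_neg_iff mult_meet le_refl)
      ultimately have "\<sim> x = c"
        using x c by (intro le_antisym) auto
      then show ?thesis
        using x y c by (simp add: imp_eq_neg mult_meet neg_meet involutive join_comm)
    qed
  qed auto
qed

end

section \<open>Splitting the carrier into two parts\<close>

locale CIdInRL_splitting = CIdInRL A for A :: "('a, 'm) rl_scheme" (structure) +
  fixes e p b :: 'a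
  assumes e_closed [simp, intro]: "e \<in> carrier A"
    and p_closed [simp, intro]: "p \<in> carrier A"
    and b_closed [simp, intro]: "b \<in> carrier A"
    and one_le_e: "\<one> \<preceq> e"
    and one_le_p: "\<one> \<preceq> p"
    and e_not_le_p: "\<not> e \<preceq> p"
    and e_meet_p: "e \<curlywedge> p = \<one>"
    and splitting: "\<lbrakk>q \<in> carrier A; \<one> \<preceq> q\<rbrakk> \<Longrightarrow> e \<preceq> q \<or> q \<preceq> p"
    and zero_le_b: "\<zero> \<preceq> b"
    and b_le_one: "b \<preceq> \<one>"
    and e_mult_b: "e \<otimes> b = e"
    and b_least: "\<lbrakk>y \<in> carrier A; \<zero> \<preceq> y; y \<preceq> \<one>; e \<otimes> y = e\<rbrakk> \<Longrightarrow> b \<preceq> y"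
begin

definition c where "c = \<sim> p"

definition lower where "lower = {x \<in> carrier A. e \<otimes> x = x}"

definition upper where "upper = {x \<in> carrier A. c \<preceq> x \<and> x \<preceq> p}"

lemma c_closed [simp, intro]: "c \<in> carrier A"
  by (simp add: c_def)

lemma neg_c: "\<sim> c = p"
  by (simp add: c_def involutive)

lemma c_le_zero: "c \<preceq> \<zero>"
  using one_le_p by (simp add: c_def neg_le_zero_iff)

lemma c_le_one: "c \<preceq> \<one>"
  using c_le_zero zero_le_one le_trans by blast

text \<open>De Morgan dual of \<open>e_meet_p\<close>.\<close>

lemma zero_eq_join: "\<zero> = \<sim> e \<curlyvee> c"
  using neg_meet[of e p] e_meet_p by (simp add: neg_one c_def)

lemma e_mult_e: "e \<otimes> e = e"
  by (simp add: mult_idem)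

lemma lower_carrier: "x \<in> lower \<Longrightarrow> x \<in> carrier A"
  and upper_carrier: "x \<in> upper \<Longrightarrow> x \<in> carrier A"
  by (simp_all add: lower_def upper_def)

lemma neg_upper: "x \<in> upper \<Longrightarrow> \<sim> x \<in> upper"
  using neg_le_iff[of p x] neg_le_neg_iff[of x c] by (auto simp: upper_def c_def involutive neg_le_neg_iff)

lemma local_one_le_p: "x \<in> upper \<Longrightarrow> \<I> x \<preceq> p"
  using neg_upper[of x] by (auto simp: upper_def local_one_def join_le_iff)

text \<open>The local unit decides: \<open>x\<close> is in \<open>lower\<close> when
  \<open>e \<preceq> \<I> x\<close> and in \<open>upper\<close> when
  \<open>\<I> x \<preceq> p\<close>. One of the two holds by \<open>splitting\<close>, and
  \<open>e_not_le_p\<close> excludes both at once.\<close>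

lemma lower_iff_not_upper:
  assumes x: "x \<in> carrier A"
  shows "x \<in> lower \<longleftrightarrow> x \<notin> upper"
proof
  assume "x \<in> lower"
  then have "e \<preceq> \<I> x"
    using x by (simp add: lower_def le_local_one_iff le_refl)
  then show "x \<notin> upper"
    using x local_one_le_p[of x] e_not_le_p le_trans[of e "\<I> x" p] by auto
next
  assume "x \<notin> upper"
  moreover have "x \<in> upper" if "\<I> x \<preceq> p"
    using x that neg_le_iff[of p x] by (auto simp: upper_def local_one_def join_le_iff c_def)
  ultimately have "e \<preceq> \<I> x"
    using x splitting[of "\<I> x"] one_le_local_one by auto
  then show "x \<in> lower"
    using x one_le_e by (simp add: lower_def le_local_one_iff le_mult_right le_antisym)
qed

lemma carrier_eq: "lower \<union> upper = carrier A"
  using lower_iff_not_upper lower_carrier upper_carrier by blast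

lemma lower_inter_upper: "lower \<inter> upper = {}"
  using lower_iff_not_upper lower_carrier by blast

lemma neg_lower: "x \<in> lower \<Longrightarrow> \<sim> x \<in> lower"
  using lower_iff_not_upper neg_upper involutive lower_carrier by (metis neg_closed)

lemma mult_lower: "\<lbrakk>x \<in> lower; y \<in> carrier A\<rbrakk> \<Longrightarrow> x \<otimes> y \<in> lower"
  by (simp add: lower_def m_assoc[symmetric])

lemma join_lower: "\<lbrakk>x \<in> lower; y \<in> lower\<rbrakk> \<Longrightarrow> x \<curlyvee> y \<in> lower"
  by (simp add: lower_def mult_join_distrib)

lemma meet_lower: "\<lbrakk>x \<in> lower; y \<in> lower\<rbrakk> \<Longrightarrow> x \<curlywedge> y \<in> lower"
  using neg_lower[OF join_lower[OF neg_lower neg_lower], of x y]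
  by (simp add: neg_join involutive lower_carrier)

lemma imp_lower: "\<lbrakk>x \<in> lower; y \<in> lower\<rbrakk> \<Longrightarrow> x \<leadsto> y \<in> lower"
  by (simp add: imp_eq_neg neg_lower mult_lower lower_carrier)

lemma e_lower: "e \<in> lower"
  by (simp add: lower_def mult_idem)

lemma e_mult_lower: "x \<in> carrier A \<Longrightarrow> e \<otimes> x \<in> lower"
  using mult_lower e_lower by blast

lemma upper_ge_c: "x \<in> upper \<Longrightarrow> c \<preceq> x"
  and upper_le_p: "x \<in> upper \<Longrightarrow> x \<preceq> p"
  by (simp_all add: upper_def)

lemma mult_upper: "\<lbrakk>x \<in> upper; y \<in> upper\<rbrakk> \<Longrightarrow> x \<otimes> y \<in> upper"
  using mult_mono[of c x c y] mult_mono[of x p y p] by (simp add: upper_def mult_idem)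

lemma join_upper: "\<lbrakk>x \<in> upper; y \<in> upper\<rbrakk> \<Longrightarrow> x \<curlyvee> y \<in> upper"
  using le_trans[of c x "x \<curlyvee> y"] by (simp add: upper_def join_le_iff join_ge1)

lemma meet_upper: "\<lbrakk>x \<in> upper; y \<in> upper\<rbrakk> \<Longrightarrow> x \<curlywedge> y \<in> upper"
  using neg_upper[OF join_upper[OF neg_upper neg_upper], of x y]
  by (simp add: neg_join involutive upper_carrier)

lemma imp_upper: "\<lbrakk>x \<in> upper; y \<in> upper\<rbrakk> \<Longrightarrow> x \<leadsto> y \<in> upper"
  by (simp add: imp_eq_neg neg_upper mult_upper upper_carrier)

lemma one_upper: "\<one> \<in> upper" and zero_upper: "\<zero> \<in> upper"
proof -
  show "\<one> \<in> upper"
    using one_le_p c_le_one by (simp add: upper_def)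
  then show "\<zero> \<in> upper"
    using neg_upper neg_one by fastforce
qed

lemma c_upper: "c \<in> upper"
  using c_le_one one_le_p le_trans[of c \<one> p] by (simp add: upper_def le_refl)

text \<open>The product is squeezed between \<open>c \<otimes> c\<close> and
  \<open>p \<otimes> c\<close>, and the latter is \<open>c \<curlywedge> p\<close> because
  \<open>p = \<sim> c\<close>. Thus \<open>c\<close> is the bottom of \<open>upper\<close> in the
  monoidal order.\<close>

lemma c_mult_upper:
  assumes "x \<in> upper"
  shows "c \<otimes> x = c"
proof (rule le_antisym)
  have "\<sim> c \<otimes> c = c \<otimes> \<sim> c"
    by (simp add: m_comm)
  then have "p \<otimes> c \<preceq> c"
    using mult_neg[of c] meet_le1[of c p] by (simp add: neg_c)
  moreover have "c \<otimes> x \<preceq> p \<otimes> c"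
    using assms mult_mono_left[of x p c] by (simp add: upper_def m_comm)
  ultimately show "c \<otimes> x \<preceq> c"
    using assms le_trans[of "c \<otimes> x" "p \<otimes> c" c] by (simp add: upper_carrier)
  show "c \<preceq> c \<otimes> x"
    using assms mult_mono_left[of c x c] by (simp add: upper_def mult_idem)
qed (use assms upper_carrier in auto)

lemma b_upper: "b \<in> upper"
  using le_trans[OF c_le_zero zero_le_b] le_trans[OF b_le_one one_le_p] by (simp add: upper_def)

section \<open>The two parts as algebras\<close>

definition L where "L = A\<lparr>carrier := lower, one := e, rl_zero := \<sim> e\<rparr>"

definition U where "U = A\<lparr>carrier := upper\<rparr>"

lemma L_simps [simp]:
  "carrier L = lower" "mult L = mult A" "one L = e" "rl_meet L = rl_meet A"
  "rl_join L = rl_join A" "rl_imp L = rl_imp A" "rl_zero L = \<sim> e"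
  by (simp_all add: L_def)

lemma U_simps [simp]:
  "carrier U = upper" "mult U = mult A" "one U = \<one>" "rl_meet U = rl_meet A"
  "rl_join U = rl_join A" "rl_imp U = rl_imp A" "rl_zero U = \<zero>"
  by (simp_all add: U_def)

lemma le_L [simp]: "rl_le L = rl_le A" and le_U [simp]: "rl_le U = rl_le A"
  by (simp_all add: rl_le_def fun_eq_iff)

lemma neg_U [simp]: "rl_neg U = rl_neg A"
  by (simp add: rl_neg_def fun_eq_iff)

text \<open>This is why the zero of \<open>L\<close> is \<open>\<sim> e\<close>: the element
  \<open>x \<leadsto> \<sim> e\<close> is the negation of \<open>e \<otimes> x\<close>, which is
  \<open>x\<close> on \<open>lower\<close>. The involution is inherited although the unit
  changes.\<close>

lemma neg_L: "x \<in> lower \<Longrightarrow> rl_neg L x = \<sim> x"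
  by (simp add: rl_neg_def[of L] imp_eq_neg involutive lower_def)

lemma CIdInRL_L: "CIdInRL L"
proof -
  interpret comm_monoid L
    by unfold_locales
      (auto simp: m_ac mult_lower lower_carrier e_lower, auto simp: lower_def m_comm)
  show ?thesis
    by unfold_locales
      (auto simp: lower_carrier meet_lower join_lower imp_lower e_lower neg_lower neg_L mult_idem
        residuation involutive meet_assoc join_assoc meet_join_absorb join_meet_absorb
        intro: meet_comm join_comm)
qed

lemma CIdInRL_U: "CIdInRL U"
proof -
  interpret comm_monoid U
    by unfold_locales (auto simp: m_ac mult_upper upper_carrier one_upper)
  show ?thesis
    by unfold_locales
      (auto simp: upper_carrier meet_upper join_upper imp_upper zero_upper mult_idem
        residuation involutive meet_assoc join_assoc meet_join_absorb join_meet_absorb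
        intro: meet_comm join_comm)
qed

section \<open>Multiplication by \<open>e\<close> as a bijection from \<open>cod\<close> onto
  \<open>dom\<close>\<close>

abbreviation cod where "cod \<equiv> glue_cod U b"

abbreviation dom where "dom \<equiv> glue_dom L (e \<otimes> c)"

definition \<phi> where "\<phi> = inv_into cod (\<lambda>w. e \<otimes> w)"

lemma cod_iff: "w \<in> cod \<longleftrightarrow> w \<in> upper \<and> w \<otimes> b = w"
  by (simp add: glue_cod_def monoidal_le_def)

lemma dom_iff: "x \<in> dom \<longleftrightarrow> x \<in> lower \<and> e \<otimes> c \<otimes> x = e \<otimes> c"
  by (simp add: glue_dom_def monoidal_le_def)

lemma neg_e_le_zero: "\<sim> e \<preceq> \<zero>"
  using one_le_e by (simp add: neg_le_zero_iff)

lemma neg_mult_self_le_zero: "x \<in> carrier A \<Longrightarrow> x \<otimes> \<sim> x \<preceq> \<zero>"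
  by (simp add: le_iff_mult_neg[symmetric] le_refl)

text \<open>As \<open>\<zero> = \<sim> e \<curlyvee> c\<close> and \<open>c \<preceq> z\<close>,
  only \<open>\<sim> e \<preceq> z\<close> is at stake, that is,
  \<open>\<sim> e \<otimes> \<sim> z \<preceq> \<zero>\<close>. That product lies below
  \<open>\<sim> (e \<otimes> z)\<close>, which the hypothesis puts below
  \<open>\<zero>\<close>.\<close>

lemma zero_le_if_one_le_e_mult:
  assumes z: "z \<in> upper" and one: "\<one> \<preceq> e \<otimes> z"
  shows "\<zero> \<preceq> z"
proof -
  have zA: "z \<in> carrier A"
    using z by (rule upper_carrier)
  have "(e \<otimes> z) \<otimes> (\<sim> e \<otimes> \<sim> z) = (e \<otimes> \<sim> e) \<otimes> (z \<otimes> \<sim> z)"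
    using zA by (simp add: m_ac)
  also have "(e \<otimes> \<sim> e) \<otimes> (z \<otimes> \<sim> z) \<preceq> \<zero> \<otimes> \<zero>"
    using zA by (intro mult_mono neg_mult_self_le_zero) auto
  finally have "\<sim> e \<otimes> \<sim> z \<preceq> \<sim> (e \<otimes> z)"
    using zA by (simp add: le_neg_iff mult_idem)
  moreover have "\<sim> (e \<otimes> z) \<preceq> \<zero>"
    using zA one by (simp add: neg_le_zero_iff)
  ultimately have "\<sim> e \<otimes> \<sim> z \<preceq> \<zero>"
    using zA le_trans[of "\<sim> e \<otimes> \<sim> z" "\<sim> (e \<otimes> z)" \<zero>] by simp
  then have "\<sim> e \<curlyvee> c \<preceq> z"
    using zA z by (simp add: join_le_iff le_iff_mult_neg[of "\<sim> e"] upper_ge_c)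
  then show ?thesis
    by (simp flip: zero_eq_join)
qed

text \<open>The truncation \<open>z \<curlywedge> \<one>\<close> lies in the interval from
  \<open>\<zero>\<close> to \<open>\<one>\<close> and is shown to be absorbed by \<open>e\<close>;
  then \<open>b_least\<close> applies to it.\<close>

lemma b_le_if_one_le_e_mult:
  assumes z: "z \<in> upper" and one: "\<one> \<preceq> e \<otimes> z"
  shows "b \<preceq> z"
proof -
  have zA: "z \<in> carrier A"
    using z by (rule upper_carrier)
  define y where "y = z \<curlywedge> \<one>"
  \<comment> \<open>The inequality \<open>e \<preceq> e \<otimes> y\<close> is equivalent to
    \<open>v \<preceq> \<zero>\<close>. Idempotence reduces this to
    \<open>v \<preceq> \<sim> y\<close> and
    \<open>v \<otimes> \<sim> y \<preceq> \<zero>\<close>.\<close>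
  define v where "v = e \<otimes> \<sim> (e \<otimes> y)"
  have closed': "y \<in> carrier A" "v \<in> carrier A"
    using zA by (simp_all add: y_def v_def)
  have zero: "\<zero> \<preceq> z"
    using z one by (rule zero_le_if_one_le_e_mult)
  have neg_y: "\<sim> y = \<sim> z \<curlyvee> \<zero>"
    using zA by (simp add: y_def neg_meet neg_one)
  have "\<sim> y \<preceq> \<one>"
    using zA zero neg_le_neg_iff[of \<zero> z] by (simp add: neg_y join_le_iff neg_zero zero_le_one)
  moreover have v_le: "v \<preceq> \<sim> y"
    using closed' by (simp add: v_def le_imp_iff[symmetric] le_refl)
  ultimately have v_one: "v \<preceq> \<one>"
    using closed' le_trans[of v "\<sim> y" \<one>] by simp
  have "e \<otimes> (v \<otimes> \<sim> z) = v \<otimes> \<sim> z"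
    using closed' zA by (simp add: v_def m_assoc[symmetric] e_mult_e)
  then have "v \<otimes> \<sim> z \<preceq> \<sim> (e \<otimes> z)"
    using closed' zA v_one by (simp add: le_imp_iff mult_le_right)
  then have "v \<otimes> \<sim> z \<preceq> \<zero>"
    using closed' zA one le_trans[of _ "\<sim> (e \<otimes> z)" \<zero>] by (simp add: neg_le_zero_iff)
  moreover have "v \<otimes> \<zero> \<preceq> \<zero>"
    using v_one closed' by (simp add: mult_le_right)
  ultimately have "v \<otimes> \<sim> y \<preceq> \<zero>"
    using closed' zA by (simp add: neg_y mult_join_distrib join_le_iff)
  moreover have "v \<preceq> v \<otimes> \<sim> y"
    using mult_mono_left[OF v_le, of v] closed' by (simp add: mult_idem)
  ultimately have "v \<preceq> \<zero>"
    using closed' le_trans[of v "v \<otimes> \<sim> y" \<zero>] by simp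
  then have "e \<preceq> e \<otimes> y"
    using closed' by (simp add: v_def le_iff_mult_neg[of e])
  moreover have "e \<otimes> y \<preceq> e"
    using zA by (simp add: y_def mult_le_left meet_le2)
  ultimately have "e \<otimes> y = e"
    using closed' by (intro le_antisym) auto
  then have "b \<preceq> y"
    using zA zero by (intro b_least) (auto simp: y_def le_meet_iff meet_le2 zero_le_one)
  then show ?thesis
    using zA by (simp add: y_def le_meet_iff)
qed

text \<open>The element \<open>\<I> y'\<close> fixes \<open>e \<otimes> y' = e \<otimes> y\<close>,
  so it lies below \<open>\<I> (e \<otimes> y)\<close> and hence below
  \<open>e \<curlyvee> \<I> y\<close>. By distributivity the joinand \<open>e\<close> contributes
  only \<open>\<I> y' \<curlywedge> e\<close>, which is below
  \<open>e \<curlywedge> p = \<one>\<close>.\<close>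

lemma local_one_le_if_e_mult_eq:
  assumes y: "y \<in> upper" and y': "y' \<in> upper" and eq: "e \<otimes> y = e \<otimes> y'"
  shows "\<I> y' \<preceq> \<I> y"
proof -
  have A: "y \<in> carrier A" "y' \<in> carrier A"
    using y y' by (simp_all add: upper_carrier)
  have "\<I> y' \<otimes> (e \<otimes> y') = e \<otimes> (\<I> y' \<otimes> y')"
    using A by (simp add: m_ac)
  then have "\<I> y' \<preceq> \<I> (e \<otimes> y)"
    using A by (simp add: le_local_one_iff eq local_one_mult le_refl)
  then have "\<I> y' \<preceq> e \<curlyvee> \<I> y"
    using A le_trans[OF _ local_one_mult_le, of "\<I> y'" e y]
    by (simp add: one_le_e mult_eq_join_positive one_le_local_one)
  then have "\<I> y' \<preceq> (\<I> y' \<curlywedge> e) \<curlyvee> (\<I> y' \<curlywedge> \<I> y)"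
    using A by (simp add: positive_meet_join[symmetric] one_le_local_one one_le_e le_meet_iff le_refl)
  moreover have "\<I> y' \<curlywedge> e \<preceq> \<I> y"
  proof -
    have "\<I> y' \<curlywedge> e \<preceq> e \<curlywedge> p"
      using A local_one_le_p[OF y'] le_trans[OF meet_le1, of "\<I> y'" e p]
      by (simp add: le_meet_iff meet_le2)
    then show ?thesis
      using A le_trans[of "\<I> y' \<curlywedge> e" \<one> "\<I> y"] by (simp add: e_meet_p one_le_local_one)
  qed
  moreover have "\<I> y' \<curlywedge> \<I> y \<preceq> \<I> y"
    using A by (simp add: meet_le2)
  ultimately show ?thesis
    using A le_trans[of "\<I> y'" "(\<I> y' \<curlywedge> e) \<curlyvee> (\<I> y' \<curlywedge> \<I> y)" "\<I> y"] by (simp add: join_le_iff)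
qed

lemma le_if_e_mult_eq:
  assumes y: "y \<in> cod" and y': "y' \<in> cod" and eq: "e \<otimes> y = e \<otimes> y'"
  shows "y \<preceq> y'"
proof -
  have up: "y \<in> upper" "y' \<in> upper" and yb: "y \<otimes> b = y"
    using y y' by (simp_all add: cod_iff)
  have A: "y \<in> carrier A" "y' \<in> carrier A"
    using up by (simp_all add: upper_carrier)
  define z where "z = \<sim> y \<curlyvee> y'"
  have z: "z \<in> upper" and zA: "z \<in> carrier A"
    using up A by (simp_all add: z_def join_upper neg_upper)
  \<comment> \<open>Replacing \<open>y'\<close> by \<open>y\<close> under the factor
    \<open>e\<close> turns \<open>z\<close> into the local unit of \<open>y\<close>, which is
    positive.\<close>
  have "e \<otimes> z = e \<otimes> \<I> y"
    using A eq by (simp add: z_def local_one_def mult_join_distrib join_comm)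
  then have "\<one> \<preceq> e \<otimes> z"
    using A le_trans[OF one_le_local_one le_mult_right, of y e] by (simp add: one_le_e)
  then have "b \<preceq> z"
    by (rule b_le_if_one_le_e_mult[OF z])
  then have "y \<otimes> b \<preceq> y \<otimes> z"
    using A zA by (simp add: mult_mono_left)
  then have "y \<preceq> (y \<otimes> \<sim> y) \<curlyvee> (y \<otimes> y')"
    using A by (simp add: z_def yb mult_join_distrib)
  \<comment> \<open>The preceding lemma, used in both directions, compares the local units of
    \<open>y\<close> and \<open>y'\<close>; one direction bounds this joinand, the other bounds
    \<open>y \<otimes> y'\<close>.\<close>
  moreover have "y \<otimes> \<sim> y \<preceq> y'"
  proof -
    have "\<sim> (\<I> y) \<preceq> \<sim> (\<I> y')"
      using A up eq by (simp add: neg_le_neg_iff local_one_le_if_e_mult_eq)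
    then have "y \<otimes> \<sim> y \<preceq> y' \<otimes> \<sim> y'"
      using A by (simp add: neg_local_one)
    then show ?thesis
      using A meet_le1[of y' "\<sim> y'"] le_trans[of "y \<otimes> \<sim> y" "y' \<otimes> \<sim> y'" y'] by (simp add: mult_neg)
  qed
  moreover have "y \<otimes> y' \<preceq> y'"
  proof -
    have "y \<preceq> \<I> y'"
      using A up eq le_trans[OF le_local_one local_one_le_if_e_mult_eq, of y y'] by simp
    then show ?thesis
      using A by (simp add: le_local_one_iff)
  qed
  ultimately show ?thesis
    using A le_trans[of y "(y \<otimes> \<sim> y) \<curlyvee> (y \<otimes> y')" y'] by (simp add: join_le_iff)
qed

lemma dom_ge: "x \<in> dom \<Longrightarrow> e \<otimes> c \<preceq> x"
  using mult_mono_left[of "e \<otimes> c" e x]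
  by (auto simp: dom_iff lower_def mult_le_left c_le_one m_comm)

lemma dom_le:
  assumes "x \<in> dom"
  shows "c \<preceq> x"
  using assms dom_ge[OF assms] le_trans[OF le_mult_right, of e c x] one_le_e
  by (simp add: dom_iff lower_carrier)

text \<open>The surjectivity half. For \<open>y = x \<curlywedge> p\<close>, the bound
  \<open>x \<preceq> x \<otimes> \<I> y\<close> and \<open>\<sim> y = \<sim> x \<curlyvee> c\<close>
  leave three products to put below \<open>e \<otimes> y\<close>: those of \<open>x\<close> with
  \<open>y\<close>, \<open>\<sim> x\<close> and \<open>c\<close>.\<close>

lemma e_mult_meet_p:
  assumes x: "x \<in> dom"
  shows "x \<curlywedge> p \<in> upper" "e \<otimes> (x \<curlywedge> p) = x"
proof -
  have xA: "x \<in> carrier A" and ex: "e \<otimes> x = x" and ecx: "e \<otimes> c \<otimes> x = e \<otimes> c"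
    using x by (auto simp: dom_iff lower_def)
  define y where "y = x \<curlywedge> p"
  have yA: "y \<in> carrier A"
    using xA by (simp add: y_def)
  show upper: "x \<curlywedge> p \<in> upper"
    using xA dom_le[OF x] c_upper by (simp add: upper_def le_meet_iff meet_le2)
  \<comment> \<open>Membership in \<open>dom\<close> makes \<open>\<I> x\<close> fix
    \<open>e \<otimes> c\<close>, so \<open>\<I> x\<close> is bounded by the local unit of
    \<open>e \<otimes> c\<close>, and that one by \<open>e \<curlyvee> p\<close>.\<close>
  have "\<I> x \<otimes> (e \<otimes> c \<otimes> x) = e \<otimes> c \<otimes> (\<I> x \<otimes> x)"
    using xA by (simp add: m_ac)
  then have "\<I> x \<preceq> \<I> (e \<otimes> c)"
    using xA ecx by (simp add: le_local_one_iff local_one_mult le_refl)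
  moreover have "\<I> (e \<otimes> c) \<preceq> e \<curlyvee> p"
  proof -
    have "\<I> c = p"
      using le_iff_join[of c p] upper_le_p[OF c_upper] by (simp add: local_one_def neg_c)
    then show ?thesis
      using local_one_mult_le[of e c] by (simp add: mult_eq_join_positive one_le_e one_le_p)
  qed
  ultimately have "\<I> x \<preceq> e \<curlyvee> p"
    using xA le_trans[of "\<I> x" "\<I> (e \<otimes> c)"] by simp
  moreover have "\<I> x \<preceq> e \<curlyvee> \<I> x"
    using xA by (simp add: join_ge2)
  \<comment> \<open>Products of positive elements are joins, so the right side is
    \<open>e \<curlyvee> (\<I> x \<curlywedge> p)\<close>, the meet of the two bounds just
    found.\<close>
  ultimately have local_one_le: "\<I> x \<preceq> e \<otimes> (\<I> x \<curlywedge> p)"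
    using xA by (simp add: mult_eq_join_positive le_meet_iff one_le_e one_le_p one_le_local_one
        positive_join_meet)
  have "(\<I> x \<curlywedge> p) \<otimes> y \<preceq> \<I> x \<otimes> x" "(\<I> x \<curlywedge> p) \<otimes> y \<preceq> p \<otimes> p"
    using xA by (intro mult_mono; simp add: y_def meet_le1 meet_le2)+
  then have "(\<I> x \<curlywedge> p) \<otimes> y \<preceq> y"
    using xA by (simp add: y_def le_meet_iff local_one_mult mult_idem)
  then have "e \<otimes> ((\<I> x \<curlywedge> p) \<otimes> y) \<preceq> e \<otimes> y"
    using xA yA by (simp add: mult_mono_left)
  moreover have "x \<otimes> y \<preceq> e \<otimes> ((\<I> x \<curlywedge> p) \<otimes> y)"
  proof -
    have "x \<preceq> e \<otimes> (\<I> x \<curlywedge> p)"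
      using xA local_one_le le_trans[OF le_local_one, of x] by simp
    then have "x \<otimes> y \<preceq> e \<otimes> (\<I> x \<curlywedge> p) \<otimes> y"
      using xA yA by (intro mult_mono) (auto simp: le_refl)
    then show ?thesis
      using xA yA by (simp add: m_assoc)
  qed
  ultimately have xy: "x \<otimes> y \<preceq> e \<otimes> y"
    using xA yA le_trans[of "x \<otimes> y" "e \<otimes> ((\<I> x \<curlywedge> p) \<otimes> y)"] by simp
  have "x \<otimes> \<sim> x \<preceq> y"
  proof -
    have "x \<otimes> \<sim> x \<preceq> p"
      using xA neg_mult_self_le_zero[of x] upper_le_p[OF zero_upper] le_trans[of _ \<zero> p] by simp
    then show ?thesis
      using xA by (simp add: y_def le_meet_iff) (simp add: mult_neg meet_le1)
  qed
  then have xx: "x \<otimes> \<sim> x \<preceq> e \<otimes> y"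
    using xA yA le_trans[of "x \<otimes> \<sim> x" y "e \<otimes> y"] by (simp add: le_mult_right one_le_e)
  have "x \<otimes> c = e \<otimes> c"
    using xA ex ecx by (metis c_closed e_closed m_assoc m_comm)
  then have xc: "x \<otimes> c \<preceq> e \<otimes> y"
    using upper yA by (simp add: y_def mult_mono_left upper_ge_c)
  have "x \<otimes> \<sim> y = (x \<otimes> \<sim> x) \<curlyvee> (x \<otimes> c)"
    using xA by (simp add: y_def neg_meet c_def mult_join_distrib)
  then have "x \<otimes> \<I> y \<preceq> e \<otimes> y"
    using xA yA xy xx xc by (simp add: local_one_def mult_join_distrib join_le_iff)
  moreover have "x \<preceq> x \<otimes> \<I> y"
    using xA yA by (simp add: le_mult_left one_le_local_one)
  ultimately have "x \<preceq> e \<otimes> y"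
    using xA yA le_trans[of x "x \<otimes> \<I> y"] by simp
  moreover have "e \<otimes> y \<preceq> x"
    using xA mult_mono_left[of y x e] by (simp add: ex y_def meet_le1)
  ultimately show "e \<otimes> (x \<curlywedge> p) = x"
    using xA yA by (simp add: y_def le_antisym)
qed

lemma e_mult_mult_b: "y \<in> carrier A \<Longrightarrow> e \<otimes> (y \<otimes> b) = e \<otimes> y"
  by (metis b_closed e_closed e_mult_b m_assoc m_comm)

lemma mult_b_cod: "y \<in> upper \<Longrightarrow> y \<otimes> b \<in> cod"
  by (simp add: cod_iff mult_upper b_upper upper_carrier m_assoc mult_idem)

lemma bij_betw_e_mult: "bij_betw (\<lambda>w. e \<otimes> w) cod dom"
proof (rule bij_betwI')
  fix y y' assume "y \<in> cod" "y' \<in> cod"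
  then show "e \<otimes> y = e \<otimes> y' \<longleftrightarrow> y = y'"
    using le_if_e_mult_eq[of y y'] le_if_e_mult_eq[of y' y] le_antisym[of y y']
    by (auto simp: cod_iff upper_carrier)
next
  fix y assume "y \<in> cod"
  then have y: "y \<in> upper" "y \<in> carrier A"
    by (simp_all add: cod_iff upper_carrier)
  have "e \<otimes> c \<otimes> (e \<otimes> y) = (e \<otimes> e) \<otimes> (c \<otimes> y)"
    using y by (simp add: m_ac)
  then show "e \<otimes> y \<in> dom"
    using y by (simp add: dom_iff e_mult_lower c_mult_upper mult_idem)
next
  fix x assume "x \<in> dom"
  \<comment> \<open>The witness is \<open>(x \<curlywedge> p) \<otimes> b\<close>: the factor
    \<open>b\<close> moves it into \<open>cod\<close> and is absorbed by \<open>e\<close>.\<close>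
  then show "\<exists>y \<in> cod. x = e \<otimes> y"
    using e_mult_meet_p[of x] mult_b_cod e_mult_mult_b upper_carrier by metis
qed

lemma \<phi>_e_mult: "w \<in> cod \<Longrightarrow> \<phi> (e \<otimes> w) = w"
  unfolding \<phi>_def using bij_betw_e_mult by (simp add: bij_betw_def inv_into_f_f)

lemma dom_cases:
  assumes "x \<in> dom"
  obtains w where "w \<in> cod" "x = e \<otimes> w"
  using assms bij_betw_e_mult by (auto simp: bij_betw_def)

text \<open>Inverting the inverse gives back multiplication by \<open>e\<close>, which absorbs
  \<open>b\<close>.\<close>

lemma glue_inv_eq: "y \<in> upper \<Longrightarrow> glue_inv L (e \<otimes> c) \<phi> (y \<otimes> b) = e \<otimes> y"
  unfolding glue_inv_def \<phi>_def
  using inv_into_inv_into_eq[OF bij_betw_e_mult mult_b_cod]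
  by (simp add: e_mult_mult_b upper_carrier)

section \<open>The gluing datum\<close>

lemma gluing_datum_L_U: "gluing_datum L U (e \<otimes> c) b \<phi>"
proof -
  have cod_mult: "w \<otimes> w' \<in> cod" and cod_join: "w \<curlyvee> w' \<in> cod" if "w \<in> cod" "w' \<in> cod" for w w'
    using that mult_join_distrib[of b w w']
    by (auto simp: cod_iff mult_upper join_upper upper_carrier m_assoc m_comm[of "w \<curlyvee> w'" b]
        m_comm[of w b] m_comm[of w' b])
  have \<phi>_mult: "\<phi> (x \<otimes> y) = \<phi> x \<otimes> \<phi> y" if x: "x \<in> dom" and y: "y \<in> dom" for x y
  proof -
    obtain w w' where w: "w \<in> cod" "x = e \<otimes> w" and w': "w' \<in> cod" "y = e \<otimes> w'"
      using x y dom_cases by metis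
    have "x \<otimes> y = (e \<otimes> e) \<otimes> (w \<otimes> w')"
      using w w' by (simp add: cod_iff upper_carrier m_ac)
    then show ?thesis
      using w w' cod_mult by (simp add: mult_idem \<phi>_e_mult)
  qed
  have \<phi>_join: "\<phi> (x \<curlyvee> y) = \<phi> x \<curlyvee> \<phi> y" if x: "x \<in> dom" and y: "y \<in> dom" for x y
  proof -
    obtain w w' where w: "w \<in> cod" "x = e \<otimes> w" and w': "w' \<in> cod" "y = e \<otimes> w'"
      using x y dom_cases by metis
    have "x \<curlyvee> y = e \<otimes> (w \<curlyvee> w')"
      using w w' by (simp add: cod_iff upper_carrier mult_join_distrib)
    then show ?thesis
      using w w' cod_join by (simp add: \<phi>_e_mult)
  qed
  \<comment> \<open>Both \<open>b\<close> and \<open>\<sim> b\<close> lie between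
    \<open>\<zero>\<close> and \<open>\<one>\<close>, so the local unit of \<open>b\<close> is
    \<open>\<one>\<close> and its local zero is \<open>\<zero>\<close>.\<close>
  have "\<zero> \<preceq> \<sim> b"
    using b_le_one neg_le_neg_iff[of b \<one>] by (simp add: neg_one)
  moreover have "\<sim> b \<preceq> \<one>"
    using zero_le_b neg_le_neg_iff[of \<zero> b] by (simp add: neg_zero)
  ultimately have "\<I> b \<preceq> \<one>"
    by (simp add: local_one_def join_le_iff b_le_one)
  then have "\<I> b = \<one>"
    by (simp add: le_antisym one_le_local_one)
  then have local_zero: "local_zero U b = \<zero>"
    using neg_local_one[of b] by (simp add: local_zero_def mult_neg neg_one)
  have "\<zero> \<otimes> \<zero> \<preceq> \<zero> \<otimes> b"
    using zero_le_b by (simp add: mult_mono_left)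
  then have "\<zero> \<otimes> b = \<zero>"
    by (intro le_antisym) (auto simp: mult_idem mult_le_left b_le_one)
  then have zero_cod: "\<zero> \<in> cod"
    by (simp add: cod_iff zero_upper)
  have "\<sim> e \<preceq> e"
    using le_trans[OF neg_e_le_zero le_trans[OF zero_le_one one_le_e]] by simp
  then have "e \<otimes> \<sim> e = \<sim> e"
    by (simp add: mult_neg meet_comm[of e]) (simp add: rl_le_def)
  \<comment> \<open>Since \<open>\<sim> e\<close> is the zero of \<open>L\<close>, this presents the
    argument of \<phi> in the last gluing condition as the image of \<open>\<zero>\<close> under
    multiplication by \<open>e\<close>.\<close>
  then have "e \<otimes> \<zero> = e \<otimes> c \<curlyvee> \<sim> e"
    by (simp add: zero_eq_join mult_join_distrib join_comm)
  then have \<phi>_zero: "local_zero U b = \<phi> (e \<otimes> c \<curlyvee> \<sim> e)"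
    using local_zero \<phi>_e_mult[OF zero_cod] by simp
  have "\<not> e \<otimes> c \<preceq> \<sim> e"
  proof
    assume "e \<otimes> c \<preceq> \<sim> e"
    then have "e \<otimes> c \<preceq> \<zero>"
      by (simp add: le_neg_iff m_assoc[symmetric] mult_idem)
    then show False
      using e_not_le_p le_neg_iff[of e c] by (simp add: neg_c m_comm)
  qed
  moreover have "e \<otimes> c \<in> negative_cone L" "b \<in> negative_cone U"
    by (simp_all add: negative_cone_def e_mult_lower mult_le_left c_le_one b_upper b_le_one)
  moreover have "bij_betw \<phi> dom cod"
    unfolding \<phi>_def by (rule bij_betw_inv_into[OF bij_betw_e_mult])
  ultimately show ?thesis
    by (intro gluing_datum.intro CIdInRL_L CIdInRL_U gluing_datum_axioms.intro)
      (simp_all add: lower_inter_upper \<phi>_mult \<phi>_join \<phi>_zero)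
qed

section \<open>Recovering the operations from the gluing\<close>

lemma glue_neg_eq: "x \<in> carrier A \<Longrightarrow> glue_neg L U x = \<sim> x"
  by (simp add: glue_neg_def neg_L)

lemma mixed_mult:
  assumes "x \<in> lower" "y \<in> upper"
  shows "x \<otimes> glue_inv L (e \<otimes> c) \<phi> (y \<otimes> b) = x \<otimes> y"
proof -
  have "x \<otimes> (e \<otimes> y) = (e \<otimes> x) \<otimes> y"
    using assms by (simp add: m_ac lower_carrier upper_carrier)
  then show ?thesis
    using assms by (simp add: glue_inv_eq lower_def)
qed

lemma glue_mult_eq:
  "\<lbrakk>x \<in> carrier A; y \<in> carrier A\<rbrakk> \<Longrightarrow> glue_mult L U (e \<otimes> c) b \<phi> x y = x \<otimes> y"
  using lower_iff_not_upper[of x] lower_iff_not_upper[of y]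
  by (auto simp: glue_mult_def mixed_mult m_comm[of y x])

text \<open>The case condition amounts to \<open>x \<preceq> p\<close>. If it holds, \<phi> returns
  \<open>(x \<curlyvee> c) \<otimes> b = x \<curlyvee> c\<close>, and \<open>c\<close> disappears
  under \<open>y\<close>. Otherwise \<open>x \<curlyvee> y\<close> is not below \<open>p\<close>,
  hence in \<open>lower\<close>, and multiplying it by \<open>e\<close> replaces \<open>y\<close> by
  \<open>e \<otimes> y\<close>.\<close>

lemma mixed_join:
  assumes x: "x \<in> lower" and y: "y \<in> upper"
  shows "glue_join L U (e \<otimes> c) b \<phi> x y = x \<curlyvee> y" "glue_join L U (e \<otimes> c) b \<phi> y x = x \<curlyvee> y"
proof -
  have "y \<notin> lower"
    using y lower_inter_upper by blast
  then have glue_join: "glue_join L U (e \<otimes> c) b \<phi> x y = (if x \<preceq> rl_neg L (e \<otimes> c)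
      then \<phi> (x \<curlyvee> e \<otimes> c) \<curlyvee> y else x \<curlyvee> glue_inv L (e \<otimes> c) \<phi> (y \<otimes> b))"
    "glue_join L U (e \<otimes> c) b \<phi> y x = glue_join L U (e \<otimes> c) b \<phi> x y"
    using x by (simp_all add: glue_join_def)
  have A: "x \<in> carrier A" "y \<in> carrier A" and ex: "e \<otimes> x = x"
    using x y by (simp_all add: lower_def upper_carrier)
  have "e \<otimes> c \<otimes> x = c \<otimes> x"
    using A ex by (metis c_closed e_closed m_assoc m_comm)
  then have iff: "x \<preceq> rl_neg L (e \<otimes> c) \<longleftrightarrow> x \<preceq> p"
    using A le_neg_iff[of x c] by (simp add: neg_L e_mult_lower le_neg_iff neg_c)
  show "glue_join L U (e \<otimes> c) b \<phi> x y = x \<curlyvee> y"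
  proof (cases "x \<preceq> p")
    case True
    then have up: "x \<curlyvee> c \<in> upper"
      using A c_upper by (simp add: upper_def join_le_iff join_ge2)
    have "x \<curlyvee> e \<otimes> c = e \<otimes> ((x \<curlyvee> c) \<otimes> b)"
      using A ex by (simp add: e_mult_mult_b mult_join_distrib)
    then have "\<phi> (x \<curlyvee> e \<otimes> c) = (x \<curlyvee> c) \<otimes> b"
      using up by (simp add: \<phi>_e_mult mult_b_cod)
    also have "\<dots> = b \<otimes> x \<curlyvee> b \<otimes> c"
      using A by (simp add: m_comm[of _ b] mult_join_distrib)
    also have "b \<otimes> x = x"
      using A ex by (metis b_closed e_closed e_mult_b m_assoc m_comm)
    also have "b \<otimes> c = c"
      using c_mult_upper[OF b_upper] by (simp add: m_comm)
    finally have "\<phi> (x \<curlyvee> e \<otimes> c) \<curlyvee> y = x \<curlyvee> (c \<curlyvee> y)"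
      using A by (simp add: join_assoc)
    also have "c \<curlyvee> y = y"
      using A upper_ge_c[OF y] by (simp add: le_iff_join[symmetric])
    finally show ?thesis
      using True iff by (simp add: glue_join)
  next
    case False
    have "x \<curlyvee> y \<notin> upper"
      using A False le_trans[OF join_ge1, of x y p] by (auto simp: upper_def)
    then have "e \<otimes> (x \<curlyvee> y) = x \<curlyvee> y"
      using A lower_iff_not_upper[of "x \<curlyvee> y"] by (simp add: lower_def)
    then show ?thesis
      using A False iff ex y by (simp add: glue_join glue_inv_eq mult_join_distrib)
  qed
  then show "glue_join L U (e \<otimes> c) b \<phi> y x = x \<curlyvee> y"
    by (simp add: glue_join)
qed

lemma glue_join_eq:
  assumes "x \<in> carrier A" "y \<in> carrier A"
  shows "glue_join L U (e \<otimes> c) b \<phi> x y = x \<curlyvee> y"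
proof (cases "x \<in> lower"; cases "y \<in> lower")
  assume "x \<in> lower" "y \<notin> lower"
  then show ?thesis
    using assms lower_iff_not_upper by (simp add: mixed_join)
next
  assume "x \<notin> lower" "y \<in> lower"
  then show ?thesis
    using assms lower_iff_not_upper by (simp add: mixed_join join_comm)
qed (simp_all add: glue_join_def)

text \<open>An isomorphism rather than an equality of records, because the operations are compared
  on the carrier only.\<close>

lemma id_rl_iso_gluing: "id \<in> rl_iso (gluing L U (e \<otimes> c) b \<phi>) A"
proof -
  have imp: "x \<leadsto> y = \<sim> (\<sim> y \<otimes> x)" if "x \<in> carrier A" "y \<in> carrier A" for x y
    using that by (rule imp_eq_neg)
  show ?thesis
    by (auto simp: rl_iso_def iso_def hom_def gluing_def carrier_eq glue_neg_eq glue_mult_eq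
        glue_join_eq neg_join involutive imp)
qed

lemma card_lower: "finite (carrier A) \<Longrightarrow> card lower < card (carrier A)"
  and card_upper: "finite (carrier A) \<Longrightarrow> card upper < card (carrier A)"
  using carrier_eq lower_inter_upper e_lower one_upper by (auto intro!: psubset_card_mono)

end

section \<open>Existence of splitting elements\<close>

context CIdInRL
begin

lemma exists_splitting:
  assumes fin: "finite (carrier A)" and q: "q \<in> carrier A" "\<one> \<preceq> q" "q \<noteq> \<one>"
  shows "\<exists>e p b. CIdInRL_splitting A e p b"
proof -
  define P where "P = {x \<in> carrier A. \<one> \<preceq> x}"
  obtain e where e: "e \<in> P - {\<one>}" and e_min: "\<And>x. \<lbrakk>x \<in> P - {\<one>}; x \<preceq> e\<rbrakk> \<Longrightarrow> x = e"
    using exists_minimal[OF fin, of "P - {\<one>}"] q by (auto simp: P_def)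
  have eA: "e \<in> carrier A" "\<one> \<preceq> e"
    using e by (simp_all add: P_def)
  have atom: "e \<curlywedge> x = \<one>" if "x \<in> carrier A" "\<one> \<preceq> x" "\<not> e \<preceq> x" for x
  proof (rule ccontr)
    assume "e \<curlywedge> x \<noteq> \<one>"
    then have "e \<curlywedge> x = e"
      using that eA by (intro e_min) (auto simp: P_def le_meet_iff meet_le1)
    then show False
      using that by (simp add: rl_le_def)
  qed
  have prime: "\<not> e \<preceq> x \<curlyvee> y"
    if "x \<in> carrier A" "\<one> \<preceq> x" "\<not> e \<preceq> x" "y \<in> carrier A" "\<one> \<preceq> y" "\<not> e \<preceq> y" for x y
  proof
    assume "e \<preceq> x \<curlyvee> y"
    \<comment> \<open>Distributivity of the positive cone splits this meet into two meets that are
      \<open>\<one>\<close> because \<open>e\<close> is an atom.\<close>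
    then have "e = e \<curlywedge> (x \<curlyvee> y)"
      by (simp add: rl_le_def)
    also have "\<dots> = \<one>"
      using that eA by (simp add: positive_meet_join atom join_idem)
    finally show False
      using e by simp
  qed
  have "\<not> e \<preceq> \<one>"
    using e eA le_antisym by (auto simp: P_def)
  then obtain p where p: "p \<in> P" "\<not> e \<preceq> p"
    and p_max: "\<And>x. \<lbrakk>x \<in> P; \<not> e \<preceq> x; p \<preceq> x\<rbrakk> \<Longrightarrow> x = p"
    using exists_maximal[OF fin, of "{x \<in> P. \<not> e \<preceq> x}"] le_refl by (fastforce simp: P_def)
  have pA: "p \<in> carrier A" "\<one> \<preceq> p"
    using p by (simp_all add: P_def)
  define K where "K = {y \<in> carrier A. \<zero> \<preceq> y \<and> y \<preceq> \<one> \<and> e \<otimes> y = e}"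
  have "\<one> \<in> K"
    using eA by (simp add: K_def zero_le_one le_refl)
  then obtain b where b: "b \<in> K" and b_min: "\<And>x. \<lbrakk>x \<in> K; x \<preceq> b\<rbrakk> \<Longrightarrow> x = b"
    using exists_minimal[OF fin, of K] by (auto simp: K_def)
  show ?thesis
  proof (intro exI CIdInRL_splitting.intro CIdInRL_splitting_axioms.intro)
    show "CIdInRL A"
      by (rule CIdInRL_axioms)
    show "e \<curlywedge> p = \<one>"
      using pA p by (simp add: atom)
    show "e \<preceq> x \<or> x \<preceq> p" if "x \<in> carrier A" "\<one> \<preceq> x" for x
    proof (rule disjCI)
      assume "\<not> x \<preceq> p"
      show "e \<preceq> x"
      proof (rule ccontr)
        assume "\<not> e \<preceq> x"
        \<comment> \<open>\<open>p\<close> was chosen only maximal; primeness of \<open>e\<close>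
          keeps \<open>p \<curlyvee> x\<close> in the competition, so \<open>p\<close> is even the
          largest.\<close>
        then have "p \<curlyvee> x = p"
          using that pA p prime[of p x] le_trans[of \<one> p "p \<curlyvee> x"]
          by (intro p_max) (auto simp: P_def join_ge1)
        then show False
          using \<open>\<not> x \<preceq> p\<close> that pA join_ge2[of p x] by simp
      qed
    qed
    show "b \<preceq> y" if y: "y \<in> carrier A" "\<zero> \<preceq> y" "y \<preceq> \<one>" "e \<otimes> y = e" for y
    proof -
      \<comment> \<open>\<open>K\<close> is closed under products, and \<open>b \<otimes> y\<close>
        lies below \<open>b\<close> and \<open>y\<close>; hence the minimal element \<open>b\<close>
        is the least one.\<close>
      have "e \<otimes> (b \<otimes> y) = e"
        using b y eA by (simp add: K_def m_assoc[symmetric])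
      then have "b \<otimes> y \<in> K"
        using b y mult_mono[of \<zero> b \<zero> y] mult_mono[of b \<one> y \<one>] by (simp add: K_def mult_idem)
      then have "b \<otimes> y = b"
        using b y by (intro b_min) (auto simp: K_def mult_le_left)
      then show ?thesis
        using b y mult_le_right[of b y] by (simp add: K_def)
    qed
  qed (use eA pA p b in \<open>auto simp: K_def\<close>)
qed

end

section \<open>Induction on the size of the carrier\<close>

theorem theorem6p8:
  fixes A :: "'a rl"
  assumes "CIdInRL A" and "finite (carrier A)"
  shows "gluing_constructible A"
  using assms
proof (induction "card (carrier A)" arbitrary: A rule: less_induct)
  case less
  interpret CIdInRL A
    by (rule less.prems)
  show ?case
  proof (cases "\<forall>x \<in> carrier A. rl_le A \<one>\<^bsub>A\<^esub> x \<longrightarrow> x = \<one>\<^bsub>A\<^esub>")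
    case True
    then show ?thesis
      using less.prems by (intro gluing_constructible.boolean boolean_if_positive_cone_trivial) auto
  next
    case False
    then obtain e p b where "CIdInRL_splitting A e p b"
      using exists_splitting less.prems by blast
    then interpret CIdInRL_splitting A e p b .
    have "finite lower" "finite upper"
      using less.prems carrier_eq by (metis finite_Un)+
    then have "gluing_constructible L" "gluing_constructible U"
      using less.prems card_lower card_upper by (auto intro!: less.hyps CIdInRL_L CIdInRL_U)
    then show ?thesis
      using gluing_datum_L_U id_rl_iso_gluing
      by (blast intro: gluing_constructible.glue gluing_constructible.isomorphic)
  qed
qed

end
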